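(* Let $v\in\mathcal{G}^{N,\mathcal{A}}$ be a game and $\mathbf{u}$ a utility function. Then $\mathcal{A}^*$ is a balanced set of coalitions if and only if the $\mathbf{u}$-prenucleolus $N^*_{\mathbf{u}}(v)$ is nonempty.
   Context: $N$ is a nonempty finite set of players. $\mathcal{A}\subseteq 2^N$ is a family of feasible coalitions with $\emptyset,N\in\mathcal{A}$; $\mathcal{A}^*=\mathcal{A}\setminus\{\emptyset,N\}$, assumed nonempty. $\mathcal{G}^{N,\mathcal{A}}$ is the set of games, i.e. functions $v:\mathcal{A}\to\mathbb{R}$ with $v(\emptyset)=0$. For $x\in\mathbb{R}^N$, $x(S)=\sum_{i\in S}x_i$; the excess is $e(S,x)=v(S)-x(S)$; $I^*(v)=\{x\in\mathbb{R}^N: x(N)=v(N)\}$ is the set of preimputations. A utility function $\mathbf{u}$ is a family $(u_S)_{S\in\mathcal{A}^*}$ of strictly increasing continuous functions $u_S:\mathbb{R}\to\mathbb{R}$, all having the same range. The $\mathbf{u}$-excess vector $E_{\mathbf{u}}(x)\in\mathbb{R}^{|\mathcal{A}^*|}$ lists the numbers $u_S(e(S,x))$, $S\in\mathcal{A}^*$, in non-increasing order. $\le_L$ is the lexicographic order: $a\le_L b$ if $a=b$ or there is $k$ with $a_k<b_k$ and $a_i=b_i$ for all $i<k$. The $\mathbf{u}$-prenucleolus is $N^*_{\mathbf{u}}(v)=\{x\in I^*(v): E_{\mathbf{u}}(x)\le_L E_{\mathbf{u}}(y)\ \forall y\in I^*(v)\}$. A set of coalitions $\mathcal{S}\subseteq\mathcal{A}$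 is balanced if there exist weights $\lambda_S>0$ ($S\in\mathcal{S}$) with $\sum_{S\in\mathcal{S}}\lambda_S\chi_S=\chi_N$, where $\chi_T\in\mathbb{R}^N$ is the characteristic vector of $T$. *)

theory Defs
  imports "HOL-Analysis.Analysis" "HOL-Library.Multiset"
begin

text \<open>
  The player set \<open>N\<close> is the universe of an arbitrary type \<open>'n\<close> of class \<open>finite\<close>
  (hence finite and nonempty), and \<open>\<real>\<^sup>N\<close> is \<open>real ^ 'n\<close>.  Functions on a family
  of coalitions are total functions on \<open>'n set\<close>; their values outside the family
  are never used.
\<close>

definition proper_coalitions :: "'n set set \<Rightarrow> 'n set set" where
  "proper_coalitions A = A - {{}, UNIV}"

definition game :: "('n set \<Rightarrow> real) \<Rightarrow> bool" where
  "game v \<longleftrightarrow> v {} = 0"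

definition payoff :: "real ^ 'n::finite \<Rightarrow> 'n set \<Rightarrow> real" where
  "payoff x S = (\<Sum>i\<in>S. x $ i)"

definition excess :: "('n::finite set \<Rightarrow> real) \<Rightarrow> 'n set \<Rightarrow> real ^ 'n \<Rightarrow> real" where
  "excess v S x = v S - payoff x S"

definition preimputations :: "('n::finite set \<Rightarrow> real) \<Rightarrow> (real ^ 'n) set" where
  "preimputations v = {x. payoff x UNIV = v UNIV}"

definition utility_function :: "'n set set \<Rightarrow> ('n set \<Rightarrow> real \<Rightarrow> real) \<Rightarrow> bool" where
  "utility_function A u \<longleftrightarrow>
     (\<forall>S\<in>proper_coalitions A. strict_mono (u S) \<and> continuous_on UNIV (u S)) \<and>
     (\<forall>S\<in>proper_coalitions A. \<forall>T\<in>proper_coalitions A. range (u S) = range (u T))"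

text \<open>The values are collected in a multiset, so coinciding values are repeated.\<close>

definition excess_vector ::
  "'n::finite set set \<Rightarrow> ('n set \<Rightarrow> real) \<Rightarrow> ('n set \<Rightarrow> real \<Rightarrow> real) \<Rightarrow> real ^ 'n \<Rightarrow> real list" where
  "excess_vector A v u x =
     rev (sorted_list_of_multiset
       (image_mset (\<lambda>S. u S (excess v S x)) (mset_set (proper_coalitions A))))"

lemma length_excess_vector: "length (excess_vector A v u x) = card (proper_coalitions A)"
proof -
  have "length (excess_vector A v u x) = size (mset (excess_vector A v u x))"
    by (simp only: size_mset)
  then show ?thesis
    by (simp add: excess_vector_def)
qed

text \<open>
  On vectors of equal length, the library's lexicographic order on lists is the
  usual coordinatewise one.
\<close>

lemma lexordp_eq_iff_nth:
  fixes a b :: "real list"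
  assumes "length a = length b"
  shows "ord_class.lexordp_eq a b \<longleftrightarrow>
    a = b \<or> (\<exists>k<length a. a ! k < b ! k \<and> (\<forall>i<k. a ! i = b ! i))"
  using assms
proof (induction a b rule: list_induct2)
  case Nil
  then show ?case by simp
next
  case (Cons x xs y ys)
  have "(\<exists>k<length (x # xs). (x # xs) ! k < (y # ys) ! k \<and> (\<forall>i<k. (x # xs) ! i = (y # ys) ! i))
    \<longleftrightarrow> x < y \<or> x = y \<and> (\<exists>k<length xs. xs ! k < ys ! k \<and> (\<forall>i<k. xs ! i = ys ! i))"
    by (simp add: Ex_less_Suc2 All_less_Suc2) auto
  then show ?case
    using Cons.IH by (auto simp: not_less)
qed

definition prenucleolus ::
  "'n::finite set set \<Rightarrow> ('n set \<Rightarrow> real) \<Rightarrow> ('n set \<Rightarrow> real \<Rightarrow> real) \<Rightarrow> (real ^ 'n) set" where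
  "prenucleolus A v u =
     {x \<in> preimputations v. \<forall>y\<in>preimputations v.
        ord_class.lexordp_eq (excess_vector A v u x) (excess_vector A v u y)}"

definition char_vec :: "'n::finite set \<Rightarrow> real ^ 'n" where
  "char_vec T = (\<chi> i. indicator T i)"

definition balanced :: "'n::finite set set \<Rightarrow> bool" where
  "balanced B \<longleftrightarrow>
     (\<exists>w. (\<forall>S\<in>B. w S > 0) \<and> (\<Sum>S\<in>B. w S *\<^sub>R char_vec S) = char_vec UNIV)"

end

theory Submission
  imports Defs
begin

text \<open>
  Let \<open>P\<close> be the family of proper coalitions.  The link between balancedness and the
  prenucleolus is a theorem of the alternative of Stiemke type
  (\<open>balanced_or_improving_direction\<close>): if \<open>P\<close> is not balanced, then there is a transfer \<open>y\<close>
  with \<open>y(N) = 0\<close> that takes from no coalition of \<open>P\<close> and gives to at least one.  Adding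
  \<open>y\<close> to a preimputation lowers the excesses weakly, one of them strictly, and increasing
  utilities preserve this, so the \<open>u\<close>-excess vector decreases lexicographically.
  Hence no preimputation is a minimiser.

  Conversely, positive weights \<open>w\<close> with \<open>\<Sum>\<^sub>S w\<^sub>S \<chi>\<^sub>S = \<chi>\<^sub>N\<close> make
  \<open>\<Sum>\<^sub>S w\<^sub>S x(S)\<close> the same constant for all preimputations \<open>x\<close>.  Fix a preimputation and let
  \<open>t\<close> be its largest \<open>u\<close>-excess.  Since the utilities share their range, \<open>t = u\<^sub>S(b\<^sub>S)\<close> for
  every \<open>S\<close>, and a preimputation whose \<open>u\<close>-excesses are all at most \<open>t\<close> satisfies
  \<open>x(S) \<ge> v(S) - b\<^sub>S\<close>; by the constant weighted sum each \<open>x(S)\<close> is then also bounded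
  above.  These preimputations themselves need not be bounded, as the vectors \<open>\<chi>\<^sub>S\<close> need
  not span, but the set \<open>K\<close> of their payoff vectors \<open>(x(S))\<^sub>S\<close> is compact.  For all other
  preimputations the \<open>u\<close>-excess vector starts with a number larger than \<open>t\<close>, so it is enough
  to find a lexicographic minimum on \<open>K\<close>.  It is obtained by minimising the components one after the other, each on the set
  of minimisers of the preceding ones (\<open>compact_attains_lex_min\<close>); this only needs closed
  sublevel sets, which follow by counting: the \<open>k\<close>-th largest of finitely many numbers is at
  most \<open>c\<close> iff at most \<open>k\<close> of them exceed \<open>c\<close>, where \<open>k\<close> starts from \<open>0\<close>.
\<close>

section \<open>Values in decreasing order\<close>

definition decreasing_values :: "'a set \<Rightarrow> ('a \<Rightarrow> real) \<Rightarrow> real list" where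
  "decreasing_values P f = rev (sorted_list_of_multiset (image_mset f (mset_set P)))"

lemma mset_decreasing_values: "mset (decreasing_values P f) = image_mset f (mset_set P)"
  by (simp add: decreasing_values_def)

lemma length_decreasing_values: "length (decreasing_values P f) = card P"
  by (metis mset_decreasing_values size_image_mset size_mset size_mset_set)

lemma nth_decreasing_le_iff:
  fixes xs :: "'a::linorder list"
  assumes "sorted_wrt (\<ge>) xs" and "k < length xs"
  shows "xs ! k \<le> c \<longleftrightarrow> length (filter (\<lambda>a. c < a) xs) \<le> k"
  using assms
proof (induction xs arbitrary: k)
  case Nil
  then show ?case by simp
next
  case (Cons x xs)
  show ?case
  proof (cases "x \<le> c")
    case True
    then have below: "\<forall>a\<in>set (x # xs). a \<le> c"
      using Cons.prems(1) by auto
    then have "filter (\<lambda>a. c < a) (x # xs) = []"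
      by (auto simp: filter_empty_conv not_less)
    moreover have "(x # xs) ! k \<le> c"
      using below Cons.prems(2) nth_mem by blast
    ultimately show ?thesis by simp
  next
    case False
    then show ?thesis
      using Cons by (cases k) auto
  qed
qed

text \<open>
  Counting replaces sorting.  The number of values above a level is visibly monotone in the
  values, and it can only jump up near a point when the values vary continuously; both
  properties thereby pass to the components of the sorted vector.
\<close>
lemma nth_decreasing_values_le_iff:
  assumes "finite P" and "k < card P"
  shows "decreasing_values P f ! k \<le> c \<longleftrightarrow> card {s \<in> P. c < f s} \<le> k"
proof -
  let ?xs = "decreasing_values P f"
  have "sorted_wrt (\<ge>) ?xs"
    unfolding decreasing_values_def sorted_wrt_rev by simp
  then have "?xs ! k \<le> c \<longleftrightarrow> length (filter (\<lambda>a. c < a) ?xs) \<le> k"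
    by (rule nth_decreasing_le_iff) (simp add: length_decreasing_values assms)
  also have "length (filter (\<lambda>a. c < a) ?xs) = size (filter_mset (\<lambda>a. c < a) (mset ?xs))"
    by (metis mset_filter size_mset)
  also have "\<dots> = card {s \<in> P. c < f s}"
    using assms(1) by (simp add: mset_decreasing_values filter_mset_image_mset)
  finally show ?thesis .
qed

text \<open>
  Lowering values lowers every component of the sorted vector, because fewer values exceed
  any given level.  Lexicographic increase is thus impossible, and equality of the sorted
  vectors is excluded by comparing the sums of the values.
\<close>
lemma decreasing_values_improvement:
  assumes "finite P" and le: "\<And>s. s \<in> P \<Longrightarrow> g s \<le> f s"
    and "s \<in> P" and "g s < f s"
  shows "\<not> ord_class.lexordp_eq (decreasing_values P f) (decreasing_values P g)"
proof
  let ?F = "decreasing_values P f" and ?G = "decreasing_values P g"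
  assume "ord_class.lexordp_eq ?F ?G"
  then consider "?F = ?G" | k where "k < card P" "?F ! k < ?G ! k"
    by (auto simp: lexordp_eq_iff_nth length_decreasing_values)
  then show False
  proof cases
    case 1
    then have "(\<Sum>s\<in>P. f s) = (\<Sum>s\<in>P. g s)"
      by (metis mset_decreasing_values sum_unfold_sum_mset)
    moreover have "(\<Sum>s\<in>P. g s) < (\<Sum>s\<in>P. f s)"
      using assms by (intro sum_strict_mono_ex1) auto
    ultimately show False by simp
  next
    case 2
    have "card {s \<in> P. ?F ! k < g s} \<le> card {s \<in> P. ?F ! k < f s}"
      using assms(1) le by (intro card_mono) (auto intro: less_le_trans)
    also have "\<dots> \<le> k"
      using nth_decreasing_values_le_iff[OF assms(1) 2(1)] by blast
    finally have "?G ! k \<le> ?F ! k"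
      using nth_decreasing_values_le_iff[OF assms(1) 2(1)] by blast
    with 2 show False by simp
  qed
qed

section \<open>Lexicographic minima on compact sets\<close>

text \<open>
  The \<open>k\<close>-th value exceeds \<open>c\<close> iff \<open>f z s > c\<close> holds throughout some \<open>T \<subseteq> P\<close> with more
  than \<open>k\<close> elements.  This describes a finite union of finite intersections of open sets.
\<close>
lemma closed_nth_decreasing_values_le:
  fixes f :: "'a::topological_space \<Rightarrow> 's \<Rightarrow> real"
  assumes "finite P" and "k < card P"
    and cont: "\<And>s. s \<in> P \<Longrightarrow> continuous_on UNIV (\<lambda>z. f z s)"
  shows "closed {z. decreasing_values P (f z) ! k \<le> c}"
proof -
  have "k < card {s \<in> P. c < f z s} \<longleftrightarrow> (\<exists>T\<in>{T \<in> Pow P. k < card T}. \<forall>s\<in>T. c < f z s)" for z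
  proof
    assume "k < card {s \<in> P. c < f z s}"
    then show "\<exists>T\<in>{T \<in> Pow P. k < card T}. \<forall>s\<in>T. c < f z s"
      by (intro bexI[of _ "{s \<in> P. c < f z s}"]) auto
  next
    assume "\<exists>T\<in>{T \<in> Pow P. k < card T}. \<forall>s\<in>T. c < f z s"
    then obtain T where T: "T \<subseteq> P" "k < card T" "\<forall>s\<in>T. c < f z s"
      by auto
    then have "card T \<le> card {s \<in> P. c < f z s}"
      using assms(1) by (intro card_mono) auto
    with T show "k < card {s \<in> P. c < f z s}" by simp
  qed
  note card_iff = this
  have "- {z. decreasing_values P (f z) ! k \<le> c} = {z. k < card {s \<in> P. c < f z s}}"
    using nth_decreasing_values_le_iff[OF assms(1,2)] by (auto simp: not_le)
  also have "\<dots> = (\<Union>T\<in>{T \<in> Pow P. k < card T}. \<Inter>s\<in>T. {z. c < f z s})"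
    unfolding card_iff by blast
  finally have "- {z. decreasing_values P (f z) ! k \<le> c} =
      (\<Union>T\<in>{T \<in> Pow P. k < card T}. \<Inter>s\<in>T. {z. c < f z s})" .
  moreover have "open (\<Inter>s\<in>T. {z. c < f z s})" if "T \<subseteq> P" for T
    using that finite_subset[OF that assms(1)] cont
    by (intro open_INT ballI open_Collect_less continuous_on_const) auto
  ultimately have "open (- {z. decreasing_values P (f z) ! k \<le> c})"
    by (simp add: open_UN)
  then show ?thesis
    by (simp add: closed_def)
qed

text \<open>
  A lower semicontinuous function attains its minimum: the sublevel sets at the values of
  \<open>g\<close> on \<open>K\<close> form a chain, so they have the finite intersection property.
\<close>
lemma compact_attains_min_if_closed_sublevels:
  fixes g :: "'a::topological_space \<Rightarrow> 'b::linorder"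
  assumes "compact K" and "K \<noteq> {}" and closed: "\<And>c. closed {z. g z \<le> c}"
  obtains m where "m \<in> K" and "\<And>z. z \<in> K \<Longrightarrow> g m \<le> g z"
proof -
  have "K \<inter> (\<Inter>y\<in>K. {z. g z \<le> g y}) \<noteq> {}"
  proof (rule compact_imp_fip_image[OF assms(1)])
    fix Y assume Y: "finite Y" "Y \<subseteq> K"
    show "K \<inter> (\<Inter>y\<in>Y. {z. g z \<le> g y}) \<noteq> {}"
    proof (cases "Y = {}")
      case True
      then show ?thesis using assms(2) by simp
    next
      case False
      then obtain m where "m \<in> Y" "\<forall>y\<in>Y. g m \<le> g y"
        using Y(1) by (metis arg_min_least arg_min_if_finite(1))
      then show ?thesis using Y(2) by auto
    qed
  qed (rule closed)
  then obtain m where "m \<in> K" "\<forall>y\<in>K. g m \<le> g y" by auto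
  then show thesis using that by blast
qed

lemma compact_attains_lex_min:
  fixes \<theta> :: "'a::topological_space \<Rightarrow> real list"
  assumes "compact K" and "K \<noteq> {}"
    and len: "\<And>z. length (\<theta> z) = m"
    and closed: "\<And>k c. k < m \<Longrightarrow> closed {z. \<theta> z ! k \<le> c}"
  obtains x where "x \<in> K" and "\<And>y. y \<in> K \<Longrightarrow> ord_class.lexordp_eq (\<theta> x) (\<theta> y)"
proof -
  let ?lt = "\<lambda>k x y. \<exists>j<k. \<theta> x ! j < \<theta> y ! j \<and> (\<forall>i<j. \<theta> x ! i = \<theta> y ! i)"
  \<comment> \<open>\<open>L\<close> is the set of points of \<open>K\<close> that are minimal in the first \<open>k\<close> components.\<close>
  have "\<exists>L. compact L \<and> L \<noteq> {} \<and> L \<subseteq> K \<and>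
      (\<forall>x\<in>L. \<forall>y\<in>K. y \<in> L \<and> (\<forall>i<k. \<theta> x ! i = \<theta> y ! i) \<or> ?lt k x y)"
    if "k \<le> m" for k
    using that
  proof (induction k)
    case 0
    then show ?case using assms(1,2) by auto
  next
    case (Suc k)
    then obtain L where L: "compact L" "L \<noteq> {}" "L \<subseteq> K"
      and min: "\<forall>x\<in>L. \<forall>y\<in>K. y \<in> L \<and> (\<forall>i<k. \<theta> x ! i = \<theta> y ! i) \<or> ?lt k x y"
      by auto
    have cl: "closed {z. \<theta> z ! k \<le> c}" for c
      using closed Suc.prems by simp
    obtain p where p: "p \<in> L" "\<And>z. z \<in> L \<Longrightarrow> \<theta> p ! k \<le> \<theta> z ! k"
      using compact_attains_min_if_closed_sublevels[OF L(1,2) cl] by blast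
    let ?L = "L \<inter> {z. \<theta> z ! k \<le> \<theta> p ! k}"
    have "y \<in> ?L \<and> (\<forall>i<Suc k. \<theta> x ! i = \<theta> y ! i) \<or> ?lt (Suc k) x y"
      if x: "x \<in> ?L" and y: "y \<in> K" for x y
    proof (cases "?lt k x y")
      case True
      then show ?thesis using less_SucI by blast
    next
      case False
      moreover have "x \<in> L" using x by simp
      ultimately have "y \<in> L" and eq: "\<forall>i<k. \<theta> x ! i = \<theta> y ! i"
        using min y by blast+
      have xk: "\<theta> x ! k = \<theta> p ! k" "\<theta> p ! k \<le> \<theta> y ! k"
        using x p(2) \<open>y \<in> L\<close> by (auto intro: antisym)
      show ?thesis
      proof (cases "\<theta> y ! k = \<theta> p ! k")
        case True
        then show ?thesis using \<open>y \<in> L\<close> eq xk by (auto simp: less_Suc_eq)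
      next
        case False
        then have "\<theta> x ! k < \<theta> y ! k" using xk by simp
        then show ?thesis using eq by blast
      qed
    qed
    moreover have "compact ?L" using L(1) cl by (rule compact_Int_closed)
    ultimately show ?case
      using p(1) L(3) by (intro exI[of _ ?L]) auto
  qed
  from this[OF order_refl] obtain L where L: "L \<noteq> {}" "L \<subseteq> K"
      "\<forall>x\<in>L. \<forall>y\<in>K. y \<in> L \<and> (\<forall>i<m. \<theta> x ! i = \<theta> y ! i) \<or> ?lt m x y"
    by auto
  then obtain x where x: "x \<in> L" by auto
  have "ord_class.lexordp_eq (\<theta> x) (\<theta> y)" if "y \<in> K" for y
  proof -
    have "(\<forall>i<m. \<theta> x ! i = \<theta> y ! i) \<or> ?lt m x y"
      using L(3) x that by blast
    then show ?thesis
      by (auto simp: lexordp_eq_iff_nth len intro: nth_equalityI)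
  qed
  then show thesis using that x L(2) by blast
qed

section \<open>Payoffs and the theorem of the alternative\<close>

lemma payoff_eq_inner: "payoff x S = char_vec S \<bullet> x"
  by (simp add: payoff_def char_vec_def inner_vec_def indicator_def if_distrib sum.If_cases
      cong: if_cong)

text \<open>
  The vector of the \<open>x(S)\<close>, \<open>S \<in> P\<close>, embedded in the Euclidean space indexed by all
  coalitions; the zeros outside \<open>P\<close> keep coordinates bounded over which the weights have no control.
\<close>
definition restricted_payoffs :: "'n::finite set set \<Rightarrow> real ^ 'n \<Rightarrow> real ^ 'n set" where
  "restricted_payoffs P x = (\<chi> S. if S \<in> P then payoff x S else 0)"

lemma linear_restricted_payoffs: "linear (restricted_payoffs P)"
  by (intro linearI)
    (auto simp: restricted_payoffs_def payoff_eq_inner vec_eq_iff inner_right_distrib)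

lemma affine_preimputations: "affine (preimputations v)"
proof -
  have "preimputations v = {x. char_vec UNIV \<bullet> x = v UNIV}"
    by (simp add: preimputations_def payoff_eq_inner)
  then show ?thesis by (simp add: affine_hyperplane)
qed

lemma preimputations_nonempty: "preimputations (v :: 'n::finite set \<Rightarrow> real) \<noteq> {}"
proof -
  have "payoff (\<chi> i::'n. v UNIV / CARD('n)) UNIV = v UNIV"
    by (simp add: payoff_def)
  then show ?thesis by (auto simp: preimputations_def)
qed

lemma balanced_weighted_payoffs:
  assumes "(\<Sum>S\<in>P. w S *\<^sub>R char_vec S) = char_vec UNIV"
  shows "(\<Sum>S\<in>P. w S * payoff x S) = payoff x UNIV"
proof -
  have "(\<Sum>S\<in>P. w S * payoff x S) = (\<Sum>S\<in>P. w S *\<^sub>R char_vec S) \<bullet> x"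
    by (simp add: payoff_eq_inner inner_sum_left)
  then show ?thesis by (simp add: assms payoff_eq_inner)
qed

text \<open>
  The payoff vectors of transfers \<open>y\<close> with \<open>y(N) = 0\<close> form a subspace.  A point that it
  shares with the standard simplex on \<open>P\<close> gives an improving direction.  If there is none,
  a hyperplane separates the two strictly; its normal \<open>w\<close> is orthogonal to the subspace and
  positive on the vertices of the simplex.  Orthogonality says that \<open>\<Sum>\<^sub>S w\<^sub>S \<chi>\<^sub>S\<close> is
  orthogonal to all \<open>y\<close> with \<open>y(N) = 0\<close>, hence a multiple of \<open>\<chi>\<^sub>N\<close>.
\<close>
lemma balanced_or_improving_direction:
  fixes P :: "'n::finite set set"
  assumes "P \<noteq> {}" and "{} \<notin> P"
  obtains "balanced P"
  | y where "payoff y UNIV = 0" "\<And>S. S \<in> P \<Longrightarrow> 0 \<le> payoff y S" "\<exists>S\<in>P. 0 < payoff y S"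
proof -
  let ?L = "restricted_payoffs P ` {y. payoff y UNIV = 0}"
  let ?D = "convex hull ((\<lambda>S. axis S 1) ` P) :: (real ^ 'n set) set"
  have "subspace {y::real^'n. payoff y UNIV = 0}"
    unfolding payoff_eq_inner by (rule subspace_hyperplane)
  then have sub: "subspace ?L"
    by (rule linear_subspace_image[OF linear_restricted_payoffs])
  have "?D \<subseteq> {z. (\<forall>S. 0 \<le> z $ S) \<and> (\<Sum>S\<in>P. z $ S) = 1}" (is "_ \<subseteq> ?E")
  proof (rule hull_minimal)
    show "(\<lambda>S. axis S 1) ` P \<subseteq> ?E"
      by (auto simp: axis_def)
    show "convex ?E"
      by (rule convexI)
        (auto simp: sum.distrib sum_distrib_left[symmetric])
  qed
  note D = this
  show thesis
  proof (cases "?L \<inter> ?D = {}")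
    case False
    then obtain y where y: "payoff y UNIV = 0" "restricted_payoffs P y \<in> ?D"
      by auto
    with D have pos: "\<forall>S. 0 \<le> restricted_payoffs P y $ S"
      and sum1: "(\<Sum>S\<in>P. restricted_payoffs P y $ S) = 1"
      by auto
    have eq: "restricted_payoffs P y $ S = payoff y S" if "S \<in> P" for S
      using that by (simp add: restricted_payoffs_def)
    have nonneg: "0 \<le> payoff y S" if "S \<in> P" for S
      using pos eq[OF that] by metis
    have "(\<Sum>S\<in>P. payoff y S) = 1"
      using sum1 eq by simp
    then have "\<exists>S\<in>P. 0 < payoff y S"
      using sum_nonpos[of P "payoff y"] by (metis not_one_le_zero not_less)
    then show thesis
      using that(2) y(1) nonneg by blast
  next
    case True
    have "compact ?D" "?D \<noteq> {}"
      using assms(1) by (simp_all add: compact_convex_hull finite_imp_compact)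
    with True obtain w b where wL: "\<forall>z\<in>?L. w \<bullet> z < b" and wD: "\<forall>z\<in>?D. w \<bullet> z > b"
      using separating_hyperplane_closed_compact[OF subspace_imp_convex[OF sub] closed_subspace[OF sub]
          convex_convex_hull, of "(\<lambda>S. axis S 1) ` P"]
      by auto
    \<comment> \<open>A linear functional bounded above on a subspace vanishes there.\<close>
    have w0: "w \<bullet> z = 0" if "z \<in> ?L" for z
    proof (rule ccontr)
      assume "w \<bullet> z \<noteq> 0"
      then have "w \<bullet> ((b / (w \<bullet> z)) *\<^sub>R z) = b" by simp
      moreover have "(b / (w \<bullet> z)) *\<^sub>R z \<in> ?L"
        using sub that by (rule subspace_scale)
      ultimately show False using wL by force
    qed
    have "b > 0"
      using wL subspace_0[OF sub] by force
    have wpos: "0 < w $ S" if "S \<in> P" for S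
    proof -
      have "axis S 1 \<in> ?D" using that by (auto intro: hull_inc)
      then have "b < w \<bullet> axis S 1" using wD by blast
      then show ?thesis using \<open>b > 0\<close> by (simp add: inner_axis)
    qed
    define s where "s = (\<Sum>S\<in>P. w $ S *\<^sub>R char_vec S)"
    have s_inner: "s \<bullet> y = w \<bullet> restricted_payoffs P y" for y
    proof -
      have "s \<bullet> y = (\<Sum>S\<in>P. w $ S * payoff y S)"
        by (simp add: s_def inner_sum_left payoff_eq_inner)
      also have "\<dots> = w \<bullet> restricted_payoffs P y"
        by (simp add: inner_vec_def restricted_payoffs_def if_distrib sum.If_cases cong: if_cong)
      finally show ?thesis .
    qed
    have const: "s $ i = s $ j" for i j
    proof -
      have "payoff (axis i 1 - axis j 1 :: real^'n) UNIV = 0"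
        by (simp add: payoff_def sum_subtractf axis_def)
      then have "s \<bullet> (axis i 1 - axis j 1) = 0"
        unfolding s_inner by (intro w0) auto
      then show ?thesis by (simp add: inner_diff_right inner_axis)
    qed
    have s_nth: "s $ i = (\<Sum>S\<in>P. w $ S * indicator S i)" for i
      by (simp add: s_def char_vec_def)
    \<comment> \<open>The common value of the components of \<open>s\<close> is positive, so dividing by it
      normalises the weights.\<close>
    obtain S i where "S \<in> P" "i \<in> S"
      using assms by fastforce
    have "0 < s $ i"
      unfolding s_nth
      by (rule sum_pos2[OF _ \<open>S \<in> P\<close>]) (use \<open>i \<in> S\<close> \<open>S \<in> P\<close> wpos in \<open>auto simp: less_imp_le\<close>)
    have "(\<Sum>S\<in>P. (w $ S / s $ i) *\<^sub>R char_vec S) = (1 / s $ i) *\<^sub>R s"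
      by (simp add: s_def scaleR_sum_right)
    also have "\<dots> = char_vec UNIV"
      using \<open>0 < s $ i\<close> const by (simp add: vec_eq_iff char_vec_def)
    finally have "balanced P"
      unfolding balanced_def using wpos \<open>0 < s $ i\<close>
      by (intro exI[of _ "\<lambda>S. w $ S / s $ i"]) simp
    then show thesis by (rule that(1))
  qed
qed

section \<open>Balancedness and the prenucleolus\<close>

lemma excess_vector_eq:
  "excess_vector A v u x =
    decreasing_values (proper_coalitions A) (\<lambda>S. u S (excess v S x))"
  by (simp add: excess_vector_def decreasing_values_def)

text \<open>
  Moving a point of the prenucleolus along an improving direction would contradict its
  minimality.
\<close>
lemma balanced_if_prenucleolus_nonempty:
  fixes A :: "'n::finite set set"
  assumes "proper_coalitions A \<noteq> {}" and mono: "\<And>S. S \<in> proper_coalitions A \<Longrightarrow> strict_mono (u S)"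
    and "x \<in> prenucleolus A v u"
  shows "balanced (proper_coalitions A)"
proof (rule ccontr)
  assume "\<not> balanced (proper_coalitions A)"
  moreover have "{} \<notin> proper_coalitions A"
    by (simp add: proper_coalitions_def)
  ultimately obtain y where y: "payoff y UNIV = 0"
      "\<And>S. S \<in> proper_coalitions A \<Longrightarrow> 0 \<le> payoff y S" "\<exists>S\<in>proper_coalitions A. 0 < payoff y S"
    using balanced_or_improving_direction[OF assms(1)] by metis
  have add: "payoff (x + y) S = payoff x S + payoff y S" for S
    by (simp add: payoff_eq_inner inner_right_distrib)
  obtain S where S: "S \<in> proper_coalitions A" "0 < payoff y S"
    using y(3) by blast
  have "\<not> ord_class.lexordp_eq (excess_vector A v u x) (excess_vector A v u (x + y))"
    unfolding excess_vector_eq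
  proof (rule decreasing_values_improvement[OF _ _ S(1)])
    show "finite (proper_coalitions A)" by simp
    show "u T (excess v T (x + y)) \<le> u T (excess v T x)" if "T \<in> proper_coalitions A" for T
      using mono[OF that] y(2)[OF that] by (simp add: strict_mono_less_eq excess_def add)
    show "u S (excess v S (x + y)) < u S (excess v S x)"
      using mono[OF S(1)] S(2) by (simp add: strict_mono_less excess_def add)
  qed
  moreover have "x + y \<in> preimputations v"
    using assms(3) y(1) by (simp add: prenucleolus_def preimputations_def add)
  ultimately show False
    using assms(3) by (auto simp: prenucleolus_def)
qed

text \<open>
  The minimum is taken in the space of payoff vectors \<open>(x(S))\<^sub>S\<close>, through which the excess
  vector factors, since only there does balancedness provide compactness.
\<close>
lemma prenucleolus_nonempty_if_balanced:
  fixes A :: "'n::finite set set"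
  assumes "proper_coalitions A \<noteq> {}" and "utility_function A u"
    and "balanced (proper_coalitions A)"
  shows "prenucleolus A v u \<noteq> {}"
proof -
  define P where "P = proper_coalitions A"
  have mono: "strict_mono (u S)" and cont: "continuous_on UNIV (u S)" if "S \<in> P" for S
    using assms(2) that by (auto simp: utility_function_def P_def)
  have same_range: "range (u S) = range (u T)" if "S \<in> P" "T \<in> P" for S T
    using assms(2) that unfolding utility_function_def P_def by blast
  have "finite P" "P \<noteq> {}" using assms(1) by (simp_all add: P_def)
  obtain w where wpos: "\<And>S. S \<in> P \<Longrightarrow> 0 < w S"
    and w: "(\<Sum>S\<in>P. w S *\<^sub>R char_vec S) = char_vec UNIV"
    using assms(3) by (auto simp: balanced_def P_def)
  define f where "f z S = u S (v S - z $ S)" for z :: "real ^ 'n set" and S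
  define \<theta> where "\<theta> z = decreasing_values P (f z)" for z
  have E: "excess_vector A v u x = \<theta> (restricted_payoffs P x)" for x
    unfolding excess_vector_def \<theta>_def decreasing_values_def f_def P_def excess_def restricted_payoffs_def
    by (intro arg_cong[where f = rev] arg_cong[where f = sorted_list_of_multiset] image_mset_cong) simp
  have len: "length (\<theta> z) = card P" for z
    by (simp add: \<theta>_def length_decreasing_values)
  have fcont: "continuous_on UNIV (\<lambda>z. f z S)" if "S \<in> P" for S
    unfolding f_def
    by (rule continuous_on_compose2[OF cont[OF that]]) (auto intro!: continuous_intros)
  let ?I = "restricted_payoffs P ` preimputations v"
  obtain z0 where z0: "z0 \<in> ?I" using preimputations_nonempty by blast
  define t where "t = Max (f z0 ` P)"
  have "t \<in> f z0 ` P"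
    unfolding t_def using \<open>finite P\<close> \<open>P \<noteq> {}\<close> by (intro Max_in) auto
  \<comment> \<open>The common range allows the level \<open>t\<close> to be pulled back through every utility.\<close>
  then have "\<forall>S\<in>P. t \<in> range (u S)"
    using same_range unfolding f_def by blast
  then have "\<forall>S\<in>P. \<exists>r. u S r = t"
    by fastforce
  from bchoice[OF this] obtain b where b: "\<And>S. S \<in> P \<Longrightarrow> u S (b S) = t"
    by blast
  define K where "K = ?I \<inter> (\<Inter>S\<in>P. {z. f z S \<le> t})"
  have "closed ?I"
    by (metis affine_hull_linear_image linear_conv_bounded_linear
        linear_restricted_payoffs affine_preimputations
        closed_affine_hull hull_same)
  then have "closed K"
    unfolding K_def using fcont
    by (intro closed_Int closed_INT ballI closed_Collect_le continuous_on_const) auto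
  define a where "a S = (if S \<in> P then v S - b S else 0)" for S
  define C where "C = v UNIV - (\<Sum>S\<in>P. w S * a S)"
  have "K \<subseteq> cbox (\<chi> S. a S) (\<chi> S. if S \<in> P then a S + C / w S else 0)"
  proof
    fix z assume "z \<in> K"
    then obtain x where x: "payoff x UNIV = v UNIV" and z: "z = restricted_payoffs P x"
      and ft: "\<And>S. S \<in> P \<Longrightarrow> f z S \<le> t"
      by (auto simp: K_def preimputations_def)
    have zS: "z $ S = payoff x S" if "S \<in> P" for S
      using that by (simp add: z restricted_payoffs_def)
    have lower: "a S \<le> z $ S" if "S \<in> P" for S
    proof -
      have "u S (v S - z $ S) \<le> u S (b S)"
        using ft[OF that] b[OF that] by (simp add: f_def)
      then show ?thesis
        using that by (simp add: strict_mono_less_eq[OF mono[OF that]] a_def)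
    qed
    \<comment> \<open>The slacks \<open>z $ T - a T\<close> are nonnegative and have the constant weighted sum \<open>C\<close>,
      so none of them can be large.\<close>
    have upper: "z $ S \<le> a S + C / w S" if "S \<in> P" for S
    proof -
      have "w S * (z $ S - a S) \<le> (\<Sum>T\<in>P. w T * (z $ T - a T))"
        using \<open>finite P\<close> that wpos lower by (intro member_le_sum) (auto simp: less_imp_le)
      also have "\<dots> = (\<Sum>T\<in>P. w T * payoff x T) - (\<Sum>T\<in>P. w T * a T)"
        by (simp add: zS right_diff_distrib sum_subtractf)
      also have "\<dots> = C"
        by (simp add: balanced_weighted_payoffs[OF w] x C_def)
      finally show ?thesis
        using wpos[OF that] by (simp add: field_simps)
    qed
    have "z $ S = 0" "a S = 0" if "S \<notin> P" for S
      using that by (simp_all add: z restricted_payoffs_def a_def)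
    then show "z \<in> cbox (\<chi> S. a S) (\<chi> S. if S \<in> P then a S + C / w S else 0)"
      using lower upper by (auto simp: mem_box_cart)
  qed
  then have "compact K"
    using \<open>closed K\<close> bounded_cbox bounded_subset compact_eq_bounded_closed by blast
  have "z0 \<in> K"
    using z0 \<open>finite P\<close> by (auto simp: K_def t_def)
  then have "K \<noteq> {}" by blast
  have cl: "closed {z. \<theta> z ! k \<le> c}" if "k < card P" for k c
    unfolding \<theta>_def using \<open>finite P\<close> that fcont by (rule closed_nth_decreasing_values_le)
  obtain z where "z \<in> K" and min: "\<And>y. y \<in> K \<Longrightarrow> ord_class.lexordp_eq (\<theta> z) (\<theta> y)"
    using compact_attains_lex_min[OF \<open>compact K\<close> \<open>K \<noteq> {}\<close> len cl] by metis
  have "0 < card P" using \<open>finite P\<close> \<open>P \<noteq> {}\<close> by (simp add: card_gt_0_iff)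
  note first = nth_decreasing_values_le_iff[OF \<open>finite P\<close> \<open>0 < card P\<close>]
  have "ord_class.lexordp_eq (\<theta> z) (\<theta> y)" if "y \<in> ?I" for y
  proof (cases "y \<in> K")
    \<comment> \<open>Outside \<open>K\<close> the largest \<open>u\<close>-excess exceeds \<open>t\<close>, so the first component decides.\<close>
    case True
    then show ?thesis by (rule min)
  next
    case False
    then have "{S \<in> P. t < f y S} \<noteq> {}"
      using that by (auto simp: K_def not_le)
    then have "t < \<theta> y ! 0"
      using first[of "f y" t] \<open>finite P\<close> by (simp add: \<theta>_def not_le[symmetric])
    moreover have "{S \<in> P. t < f z S} = {}"
      using \<open>z \<in> K\<close> by (auto simp: K_def not_less)
    then have "\<theta> z ! 0 \<le> t"
      using first[of "f z" t] by (simp only: \<theta>_def card.empty)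
    ultimately show ?thesis
      using \<open>0 < card P\<close> by (auto simp: lexordp_eq_iff_nth len intro!: exI[of _ 0])
  qed
  moreover obtain x where "x \<in> preimputations v" "z = restricted_payoffs P x"
    using \<open>z \<in> K\<close> by (auto simp: K_def)
  ultimately have "x \<in> prenucleolus A v u"
    by (auto simp: prenucleolus_def E)
  then show ?thesis by blast
qed

theorem theorem14:
  fixes A :: "'n::finite set set"
    and v :: "'n set \<Rightarrow> real"
    and u :: "'n set \<Rightarrow> real \<Rightarrow> real"
  assumes "{} \<in> A" and "UNIV \<in> A" and "proper_coalitions A \<noteq> {}"
    and "game v"
    and "utility_function A u"
  shows "balanced (proper_coalitions A) \<longleftrightarrow> prenucleolus A v u \<noteq> {}"
proof
  assume "balanced (proper_coalitions A)"
  with assms(3,5) show "prenucleolus A v u \<noteq> {}"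
    by (rule prenucleolus_nonempty_if_balanced)
next
  assume "prenucleolus A v u \<noteq> {}"
  then obtain x where "x \<in> prenucleolus A v u" by blast
  moreover have "strict_mono (u S)" if "S \<in> proper_coalitions A" for S
    using assms(5) that by (simp add: utility_function_def)
  ultimately show "balanced (proper_coalitions A)"
    using assms(3) balanced_if_prenucleolus_nonempty by blast
qed

end
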